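(* Let $\mathcal{H}$ be a complex Hilbert space, and let $f,g,h:\mathbb{D}\rightarrow\mathcal{B}(\mathcal{H})$ be holomorphic functions such that $f(z)=h(z)\,g(\phi(z))$ for all $z\in\mathbb{D}$, for some analytic function $\phi:\mathbb{D}\rightarrow\mathbb{D}$ with $\phi(0)=0$. If $\|h(z)\|\leq M$ for $|z|<\beta\leq 1$ and $h(0)=\alpha I$ with $\alpha\in\mathbb{C}$, $|\alpha|\leq M$, then $M_{r}(f)\leq M\,M_{r}(g)$ for $0\leq r\leq \beta/3$.
   Context: $\mathbb{D}=\{z\in\mathbb{C}:|z|<1\}$; $\mathcal{B}(\mathcal{H})$ is the algebra of bounded linear operators on $\mathcal{H}$ with operator norm $\|\cdot\|$, and $I$ is the identity operator. For a holomorphic function $u:\mathbb{D}\rightarrow\mathcal{B}(\mathcal{H})$ with $u(z)=\sum_{n=0}^{\infty}U_{n}z^{n}$, $U_n\in\mathcal{B}(\mathcal{H})$, the Bohr operator is $M_{r}(u)=\sum_{n=0}^{\infty}\|U_{n}\|r^{n}$ for $0\leq r<1$. *)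

theory Defs
  imports "HOL-Complex_Analysis.Complex_Analysis"
begin

text \<open>
  Complex normed spaces. The real scalar multiplication of the library is required to be the
  restriction of the complex one, so that the real-normed theory (completeness, limits, the type
  \<open>'a \<Rightarrow>\<^sub>L 'b\<close>) applies to the same object.
\<close>

class complex_normed_vector = real_normed_vector +
  fixes scaleC :: "complex \<Rightarrow> 'a \<Rightarrow> 'a"  (infixr \<open>*\<^sub>C\<close> 75)
  assumes scaleC_add_right: "c *\<^sub>C (x + y) = c *\<^sub>C x + c *\<^sub>C y"
    and scaleC_add_left: "(c + d) *\<^sub>C x = c *\<^sub>C x + d *\<^sub>C x"
    and scaleC_scaleC: "c *\<^sub>C (d *\<^sub>C x) = (c * d) *\<^sub>C x"
    and scaleC_of_real: "complex_of_real t *\<^sub>C x = t *\<^sub>R x"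
    and norm_scaleC: "norm (c *\<^sub>C x) = cmod c * norm x"

text \<open>
  The inner product is linear in its second argument. Since the norm is already positive definite,
  the last axiom yields both positive definiteness of the inner product and the fact that
  the norm is the one it induces.
\<close>

class complex_hilbert_space = complex_normed_vector + complete_space +
  fixes cinner :: "'a \<Rightarrow> 'a \<Rightarrow> complex"
  assumes cinner_commute: "cinner x y = cnj (cinner y x)"
    and cinner_add_right: "cinner x (y + z) = cinner x y + cinner x z"
    and cinner_scaleC_right: "cinner x (c *\<^sub>C y) = c * cinner x y"
    and cinner_self: "cinner x x = complex_of_real ((norm x)\<^sup>2)"

subclass (in complex_hilbert_space) banach ..

instantiation complex :: complex_hilbert_space
begin

definition scaleC_complex :: "complex \<Rightarrow> complex \<Rightarrow> complex"
  where "scaleC_complex c x = c * x"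

definition cinner_complex :: "complex \<Rightarrow> complex \<Rightarrow> complex"
  where "cinner_complex x y = cnj x * y"

instance
proof
  fix x :: complex
  show "cinner x x = complex_of_real ((norm x)\<^sup>2)"
    unfolding cinner_complex_def by (metis complex_norm_square mult.commute)
qed (auto simp: scaleC_complex_def cinner_complex_def algebra_simps norm_mult scaleR_conv_of_real)

end

lemma bounded_linear_scaleC: "bounded_linear (\<lambda>x::'a::complex_normed_vector. c *\<^sub>C x)"
proof
  fix t :: real and x y :: 'a
  show "c *\<^sub>C (x + y) = c *\<^sub>C x + c *\<^sub>C y"
    by (rule scaleC_add_right)
  show "c *\<^sub>C (t *\<^sub>R x) = t *\<^sub>R (c *\<^sub>C x)"
    by (simp add: scaleC_of_real[symmetric] scaleC_scaleC mult.commute)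
  show "\<exists>K. \<forall>x::'a. norm (c *\<^sub>C x) \<le> norm x * K"
    by (rule exI[of _ "cmod c"]) (simp add: norm_scaleC mult.commute)
qed

instantiation blinfun :: (real_normed_vector, complex_normed_vector) complex_normed_vector
begin

lift_definition scaleC_blinfun :: "complex \<Rightarrow> ('a \<Rightarrow>\<^sub>L 'b) \<Rightarrow> ('a \<Rightarrow>\<^sub>L 'b)"
  is "\<lambda>c T x. c *\<^sub>C T x"
  by (rule bounded_linear_compose[OF bounded_linear_scaleC])

instance
proof
  fix c d :: complex and t :: real and S T :: "'a \<Rightarrow>\<^sub>L 'b"
  show "c *\<^sub>C (S + T) = c *\<^sub>C S + c *\<^sub>C T"
    by transfer (simp add: scaleC_add_right)
  show "(c + d) *\<^sub>C T = c *\<^sub>C T + d *\<^sub>C T"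
    by transfer (simp add: scaleC_add_left)
  show "c *\<^sub>C (d *\<^sub>C T) = (c * d) *\<^sub>C T"
    by transfer (simp add: scaleC_scaleC)
  show "complex_of_real t *\<^sub>C T = t *\<^sub>R T"
    by transfer (simp add: scaleC_of_real)
  have le: "norm (b *\<^sub>C R) \<le> cmod b * norm R" for b and R :: "'a \<Rightarrow>\<^sub>L 'b"
    by (rule norm_blinfun_bound)
      (auto simp: scaleC_blinfun.rep_eq norm_scaleC mult.assoc
        intro!: mult_left_mono norm_blinfun)
  show "norm (c *\<^sub>C T) = cmod c * norm T"
  proof (cases "c = 0")
    case True
    then show ?thesis using le[of c T] by simp
  next
    case False
    have "inverse c *\<^sub>C (c *\<^sub>C T) = T"
      using False scaleC_of_real[of 1 "blinfun_apply T x" for x]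
      by (intro blinfun_eqI) (simp add: scaleC_blinfun.rep_eq scaleC_scaleC)
    then have "norm T \<le> inverse (cmod c) * norm (c *\<^sub>C T)"
      using le[of "inverse c" "c *\<^sub>C T"] by (simp add: norm_inverse)
    then show ?thesis
      using False le[of c T] by (simp add: field_simps)
  qed
qed

end

text \<open>
  The elements of \<open>'h \<Rightarrow>\<^sub>L 'h\<close> are the bounded real-linear maps; the algebra of bounded
  operators on a complex Hilbert space consists of the complex-linear ones. The library norm of
  \<open>'h \<Rightarrow>\<^sub>L 'h\<close> is the operator norm.
\<close>

definition bounded_operators ::
    "('h::complex_hilbert_space \<Rightarrow>\<^sub>L 'h) set"
  where "bounded_operators = {T. \<forall>c x. blinfun_apply T (c *\<^sub>C x) = c *\<^sub>C blinfun_apply T x}"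

text \<open>Complex differentiability in norm, the vector-valued analogue of \<^const>\<open>holomorphic_on\<close>.\<close>

definition vec_holomorphic_on ::
    "(complex \<Rightarrow> 'a::complex_normed_vector) \<Rightarrow> complex set \<Rightarrow> bool"
    (infixl \<open>vec'_holomorphic'_on\<close> 50)
  where "u vec_holomorphic_on S \<longleftrightarrow>
    (\<forall>z\<in>S. \<exists>L. ((\<lambda>w. inverse (w - z) *\<^sub>C (u w - u z)) \<longlongrightarrow> L) (at z within S))"

text \<open>
  The coefficients of the expansion of \<open>u\<close> about 0 in the unit disc. For holomorphic \<open>u\<close> with
  values in a Banach space the sequence exists and is unique.
\<close>

definition disc_coeffs :: "(complex \<Rightarrow> 'a::complex_normed_vector) \<Rightarrow> nat \<Rightarrow> 'a"
  where "disc_coeffs u = (THE U. \<forall>z\<in>ball 0 1. (\<lambda>n. z ^ n *\<^sub>C U n) sums u z)"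

text \<open>For holomorphic \<open>u\<close> and \<open>0 \<le> r < 1\<close> the series converges, by Cauchy's estimates.\<close>

definition bohr_operator :: "real \<Rightarrow> (complex \<Rightarrow> 'a::complex_normed_vector) \<Rightarrow> real"
  where "bohr_operator r u = (\<Sum>n. norm (disc_coeffs u n) * r ^ n)"

end

theory Submission
  imports Defs
begin

text \<open>
  A Banach-valued holomorphic function is a power series, and Bohr's inequality for operators with
  \<open>h 0 = \<alpha> I\<close> follows from \<open>\<parallel>H n\<parallel> \<beta> ^ n \<le> 2 (M - \<bar>\<alpha>\<bar>)\<close> for \<open>n > 0\<close>: since \<open>r \<le> \<beta> / 3\<close>, the coefficients
  satisfy \<open>\<Sum> \<parallel>H n\<parallel> r ^ n \<le> \<bar>\<alpha>\<bar> + 2 (M - \<bar>\<alpha>\<bar>) (1/3 + 1/9 + \<dots>) = M\<close>. By Schwarz \<open>\<phi> z = z \<psi> z\<close> with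
  \<open>\<bar>\<psi>\<bar> \<le> 1\<close>, and the same inequality on the one-dimensional space bounds the coefficients \<open>p k\<close> of
  \<open>\<psi> ^ k\<close>. Since \<open>F n\<close> is the sum of \<open>p k j H i G k\<close> over \<open>i + j + k = n\<close>, the sums over i and j
  contribute at most \<open>M\<close> and 1.
\<close>

section \<open>Complex scalar multiplication and the inner product\<close>

lemma bounded_bilinear_scaleC:
  "bounded_bilinear (\<lambda>(c::complex) (x::'a::complex_normed_vector). c *\<^sub>C x)"
proof
  fix c d :: complex and x y :: 'a and t :: real
  show "(c + d) *\<^sub>C x = c *\<^sub>C x + d *\<^sub>C x"
    by (rule scaleC_add_left)
  show "c *\<^sub>C (x + y) = c *\<^sub>C x + c *\<^sub>C y"
    by (rule scaleC_add_right)
  show "(t *\<^sub>R c) *\<^sub>C x = t *\<^sub>R (c *\<^sub>C x)"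
    by (metis scaleC_of_real scaleC_scaleC scaleR_conv_of_real)
  show "c *\<^sub>C (t *\<^sub>R x) = t *\<^sub>R (c *\<^sub>C x)"
    by (simp add: scaleC_of_real[symmetric] scaleC_scaleC mult.commute)
  show "\<exists>K. \<forall>c (x::'a). norm (c *\<^sub>C x) \<le> norm c * norm x * K"
    by (rule exI[of _ 1]) (simp add: norm_scaleC)
qed

interpretation scaleC: bounded_bilinear "\<lambda>(c::complex) (x::'a::complex_normed_vector). c *\<^sub>C x"
  by (rule bounded_bilinear_scaleC)

lemma scaleC_one [simp]: "1 *\<^sub>C x = (x :: 'a::complex_normed_vector)"
  using scaleC_of_real[of 1 x] by simp

lemma cinner_add_left: "cinner (x + y) z = cinner x z + cinner (y::'a::complex_hilbert_space) z"
  by (metis cinner_add_right cinner_commute complex_cnj_add)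

lemma cinner_scaleC_left: "cinner (c *\<^sub>C x) z = cnj c * cinner (x::'a::complex_hilbert_space) z"
  by (metis cinner_scaleC_right cinner_commute complex_cnj_mult)

lemma cinner_zero_right [simp]: "cinner x 0 = (0::complex)" for x :: "'a::complex_hilbert_space"
  using cinner_add_right[of x 0 0] by simp

lemma cinner_diff_right: "cinner x (y - z) = cinner x y - cinner (x::'a::complex_hilbert_space) z"
  using cinner_add_right[of x "y - z" z] by (simp add: algebra_simps)

text \<open>Cauchy-Schwarz: with the chosen \<open>c\<close> the vector
  \<open>y + c *\<^sub>C x\<close> is orthogonal to \<open>x\<close>, and its squared norm, which is
  \<open>(norm y)\<^sup>2 - (norm (cinner x y))\<^sup>2 / n\<close>, is nonnegative.\<close>

lemma norm_cinner_le: "norm (cinner x y) \<le> norm x * norm (y::'a::complex_hilbert_space)"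
proof (cases "x = 0")
  case True
  then show ?thesis using cinner_commute[of x y] by simp
next
  case False
  define n where "n = (norm x)\<^sup>2"
  define c where "c = - (cinner x y / of_real n)"
  have n: "n > 0" using False by (simp add: n_def)
  have "of_real ((norm (y + c *\<^sub>C x))\<^sup>2) = cinner (y + c *\<^sub>C x) (y + c *\<^sub>C x)"
    by (rule cinner_self[symmetric])
  also have "\<dots> = cinner y y + c * cinner y x + cnj c * cinner x y + cnj c * c * cinner x x"
    by (simp add: cinner_add_left cinner_add_right cinner_scaleC_left cinner_scaleC_right algebra_simps)
  also have "\<dots> = of_real ((norm y)\<^sup>2) + c * cinner y x"
    using n by (simp add: cinner_self c_def flip: n_def)
  also have "c * cinner y x = - of_real ((norm (cinner x y))\<^sup>2 / n)"
    using cinner_commute[of y x] by (simp add: c_def complex_norm_square[unfolded of_real_power])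
  finally have "(norm (y + c *\<^sub>C x))\<^sup>2 = (norm y)\<^sup>2 - (norm (cinner x y))\<^sup>2 / n"
    unfolding of_real_minus[symmetric] of_real_add[symmetric] of_real_eq_iff by simp
  then have "(norm (cinner x y))\<^sup>2 / n \<le> (norm y)\<^sup>2"
    using zero_le_power2[of "norm (y + c *\<^sub>C x)"] by linarith
  then have "(norm (cinner x y))\<^sup>2 \<le> (norm x * norm y)\<^sup>2"
    using n by (simp add: n_def field_simps)
  then show ?thesis by (rule power2_le_imp_le) simp
qed

lemma norm_add_squared:
  "(norm (x + y))\<^sup>2 = (norm x)\<^sup>2 + 2 * Re (cinner x y) + (norm (y::'a::complex_hilbert_space))\<^sup>2"
proof -
  have "complex_of_real ((norm (x + y))\<^sup>2) = cinner (x + y) (x + y)"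
    by (rule cinner_self[symmetric])
  also have "\<dots> = cinner x x + (cinner x y + cnj (cinner x y)) + cinner y y"
    using cinner_commute[of y x] by (simp add: cinner_add_left cinner_add_right)
  finally have "Re (complex_of_real ((norm (x + y))\<^sup>2)) = Re (cinner x x + (cinner x y + cnj (cinner x y)) + cinner y y)"
    by (rule arg_cong)
  then show ?thesis by (simp add: cinner_self del: of_real_power)
qed

section \<open>Matrix coefficients of operators\<close>

text \<open>These functionals are bounded, complex linear in \<open>T\<close> and separate
  operators, so they reduce operator-valued complex analysis to the scalar theory. The test vector
  \<open>y\<close> stands on the left because \<open>cinner\<close> is linear in its second
  argument.\<close>

definition matrix_coeff :: "'a::real_normed_vector \<Rightarrow> 'b::complex_hilbert_space \<Rightarrow> ('a \<Rightarrow>\<^sub>L 'b) \<Rightarrow> complex"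
  where "matrix_coeff x y T = cinner y (blinfun_apply T x)"

lemma bounded_linear_matrix_coeff: "bounded_linear (matrix_coeff x y)"
proof (rule bounded_linear_intro)
  fix S T :: "'a \<Rightarrow>\<^sub>L 'b" and t :: real
  show "matrix_coeff x y (S + T) = matrix_coeff x y S + matrix_coeff x y T"
    by (simp add: matrix_coeff_def blinfun.add_left cinner_add_right)
  show "matrix_coeff x y (t *\<^sub>R T) = t *\<^sub>R matrix_coeff x y T"
    using cinner_scaleC_right[of y "of_real t" "blinfun_apply T x"]
    by (simp add: matrix_coeff_def blinfun.scaleR_left scaleC_of_real scaleR_conv_of_real)
  have "norm (matrix_coeff x y T) \<le> norm y * norm (blinfun_apply T x)"
    unfolding matrix_coeff_def by (rule norm_cinner_le)
  also have "\<dots> \<le> norm y * (norm T * norm x)"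
    by (intro mult_left_mono norm_blinfun) auto
  finally show "norm (matrix_coeff x y T) \<le> norm T * (norm x * norm y)"
    by (simp add: algebra_simps)
qed

lemma matrix_coeff_scaleC: "matrix_coeff x y (c *\<^sub>C T) = c * matrix_coeff x y T"
  by (simp add: matrix_coeff_def scaleC_blinfun.rep_eq cinner_scaleC_right)

lemma matrix_coeff_eqI:
  assumes "\<And>x y. matrix_coeff x y S = matrix_coeff x y T"
  shows "S = T"
proof (rule blinfun_eqI)
  fix x
  \<comment> \<open>Testing against the difference itself produces its squared norm.\<close>
  let ?d = "blinfun_apply S x - blinfun_apply T x"
  have "cinner ?d ?d = 0"
    using assms[of x ?d] by (simp add: matrix_coeff_def cinner_diff_right)
  then show "blinfun_apply S x = blinfun_apply T x"
    by (simp add: cinner_self)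
qed

section \<open>Order of vanishing at 0\<close>

text \<open>This is \<open>u z = O(z ^ N)\<close>. Taking \<open>nhds 0\<close> instead of
  \<open>at 0\<close> keeps the origin in the estimate, which forces \<open>u 0 = 0\<close> for
  \<open>N > 0\<close>; order 0 means local boundedness.\<close>

definition vanishes_order :: "nat \<Rightarrow> (complex \<Rightarrow> 'a::real_normed_vector) \<Rightarrow> bool"
  where "vanishes_order N u \<longleftrightarrow> (\<exists>K. \<forall>\<^sub>F z in nhds 0. norm (u z) \<le> K * norm z ^ N)"

lemma vanishes_orderE:
  assumes "vanishes_order N u"
  obtains K where "K > 0" "\<forall>\<^sub>F z in nhds 0. norm (u z) \<le> K * norm z ^ N"
proof -
  obtain K where K: "\<forall>\<^sub>F z in nhds 0. norm (u z) \<le> K * norm z ^ N"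
    using assms by (auto simp: vanishes_order_def)
  have "\<forall>\<^sub>F z in nhds 0. norm (u z) \<le> (\<bar>K\<bar> + 1) * norm z ^ N"
    using K
  proof eventually_elim
    case (elim z)
    have "K * norm z ^ N \<le> (\<bar>K\<bar> + 1) * norm z ^ N"
      by (intro mult_right_mono) auto
    with elim show ?case by linarith
  qed
  then show thesis using that[of "\<bar>K\<bar> + 1"] by simp
qed

lemma vanishes_order_cong:
  assumes "\<forall>\<^sub>F z in nhds 0. u z = v z" "vanishes_order N u"
  shows "vanishes_order N v"
proof -
  obtain K where K: "\<forall>\<^sub>F z in nhds 0. norm (u z) \<le> K * norm z ^ N"
    using assms(2) by (auto simp: vanishes_order_def)
  have "\<forall>\<^sub>F z in nhds 0. norm (v z) \<le> K * norm z ^ N"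
    using K assms(1) by eventually_elim simp
  then show ?thesis by (auto simp: vanishes_order_def)
qed

lemma vanishes_order_mono:
  assumes "vanishes_order N u" "m \<le> N"
  shows "vanishes_order m u"
proof -
  obtain K where K: "K > 0" "\<forall>\<^sub>F z in nhds 0. norm (u z) \<le> K * norm z ^ N"
    using assms(1) by (rule vanishes_orderE)
  have "\<forall>\<^sub>F z::complex in nhds 0. z \<in> ball 0 1"
    by (rule eventually_nhds_in_open) auto
  with K(2) have "\<forall>\<^sub>F z in nhds 0. norm (u z) \<le> K * norm z ^ m"
  proof eventually_elim
    case (elim z)
    have "K * norm z ^ N \<le> K * norm z ^ m"
      using elim(2) K(1) assms(2) by (intro mult_left_mono power_decreasing) auto
    with elim show ?case by linarith
  qed
  then show ?thesis by (auto simp: vanishes_order_def)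
qed

text \<open>Orders add under any bounded bilinear product; both \<open>*\<^sub>C\<close> and
  composition of operators are instances.\<close>

lemma vanishes_order_bilinear:
  assumes "bounded_bilinear pr" "vanishes_order m u" "vanishes_order n v"
  shows "vanishes_order (m + n) (\<lambda>z. pr (u z) (v z))"
proof -
  interpret bounded_bilinear pr by fact
  obtain C where C: "C > 0" "\<And>a b. norm (pr a b) \<le> norm a * norm b * C"
    using pos_bounded by auto
  obtain K where K: "K > 0" "\<forall>\<^sub>F z in nhds 0. norm (u z) \<le> K * norm z ^ m"
    using assms(2) by (rule vanishes_orderE)
  obtain L where L: "L > 0" "\<forall>\<^sub>F z in nhds 0. norm (v z) \<le> L * norm z ^ n"
    using assms(3) by (rule vanishes_orderE)
  have "\<forall>\<^sub>F z in nhds 0. norm (pr (u z) (v z)) \<le> (K * L * C) * norm z ^ (m + n)"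
    using K(2) L(2)
  proof eventually_elim
    case (elim z)
    have "norm (pr (u z) (v z)) \<le> norm (u z) * norm (v z) * C" by (rule C)
    also have "\<dots> \<le> (K * norm z ^ m) * (L * norm z ^ n) * C"
      using elim C(1) K(1) by (intro mult_right_mono mult_mono) auto
    finally show ?case by (simp add: power_add algebra_simps)
  qed
  then show ?thesis by (auto simp: vanishes_order_def)
qed

lemma vanishes_order_add:
  assumes "vanishes_order N u" "vanishes_order N v"
  shows "vanishes_order N (\<lambda>z. u z + v z)"
proof -
  obtain K where K: "\<forall>\<^sub>F z in nhds 0. norm (u z) \<le> K * norm z ^ N"
    using assms(1) by (auto simp: vanishes_order_def)
  obtain L where L: "\<forall>\<^sub>F z in nhds 0. norm (v z) \<le> L * norm z ^ N"
    using assms(2) by (auto simp: vanishes_order_def)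
  have "\<forall>\<^sub>F z in nhds 0. norm (u z + v z) \<le> (K + L) * norm z ^ N"
    using K L
  proof eventually_elim
    case (elim z)
    then show ?case using norm_triangle_ineq[of "u z" "v z"] by (simp add: algebra_simps)
  qed
  then show ?thesis by (auto simp: vanishes_order_def)
qed

lemma vanishes_order_uminus:
  "vanishes_order N u \<Longrightarrow> vanishes_order N (\<lambda>z. - u z)"
  by (simp add: vanishes_order_def)

lemma vanishes_order_diff:
  assumes "vanishes_order N u" "vanishes_order N v"
  shows "vanishes_order N (\<lambda>z. u z - v z)"
  using vanishes_order_add[OF assms(1) vanishes_order_uminus[OF assms(2)]] by simp

lemma vanishes_order_sum:
  assumes "\<And>i. i \<in> A \<Longrightarrow> vanishes_order N (u i)"
  shows "vanishes_order N (\<lambda>z. \<Sum>i\<in>A. u i z)"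
proof (cases "finite A")
  case True
  then show ?thesis using assms
  proof (induction A rule: finite_induct)
    case empty
    show ?case by (auto simp: vanishes_order_def intro!: exI[of _ 0])
  next
    case (insert i A)
    then show ?case by (auto intro!: vanishes_order_add)
  qed
qed (auto simp: vanishes_order_def intro!: exI[of _ 0])

lemma vanishes_order_const: "vanishes_order 0 (\<lambda>z. a)"
  by (auto simp: vanishes_order_def)

lemma vanishes_order_power: "vanishes_order n (\<lambda>z. z ^ n)"
  by (auto simp: vanishes_order_def norm_power intro!: exI[of _ 1])

lemma vanishes_order_monomial:
  "vanishes_order n (\<lambda>z. z ^ n *\<^sub>C (a::'a::complex_normed_vector))"
  using vanishes_order_bilinear[OF bounded_bilinear_scaleC vanishes_order_power vanishes_order_const]
  by simp

text \<open>The bound on \<open>\<phi>\<close> acts twice: it makes \<open>\<phi> z\<close> tend to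
  0, so that the estimate for \<open>u\<close> applies at \<open>\<phi> z\<close>, and it compares
  \<open>norm (\<phi> z) ^ N\<close> with \<open>norm z ^ N\<close>.\<close>

lemma vanishes_order_compose:
  assumes "vanishes_order N u" "\<forall>\<^sub>F z in nhds 0. norm (\<phi> z) \<le> norm z"
  shows "vanishes_order N (\<lambda>z. u (\<phi> z))"
proof -
  obtain K where K: "K > 0" "\<forall>\<^sub>F z in nhds 0. norm (u z) \<le> K * norm z ^ N"
    using assms(1) by (rule vanishes_orderE)
  have "(\<phi> \<longlongrightarrow> 0) (nhds 0)"
    by (rule Lim_null_comparison[OF assms(2)]) (intro tendsto_norm_zero filterlim_ident)
  then have "\<forall>\<^sub>F z in nhds 0. norm (u (\<phi> z)) \<le> K * norm (\<phi> z) ^ N"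
    by (rule eventually_compose_filterlim[OF K(2)])
  with assms(2) have "\<forall>\<^sub>F z in nhds 0. norm (u (\<phi> z)) \<le> K * norm z ^ N"
  proof eventually_elim
    case (elim z)
    have "K * norm (\<phi> z) ^ N \<le> K * norm z ^ N"
      using elim K(1) by (intro mult_left_mono power_mono) auto
    with elim show ?case by linarith
  qed
  then show ?thesis by (auto simp: vanishes_order_def)
qed

text \<open>Induction on \<open>N\<close>: evaluation at 0 kills \<open>A 0\<close>, and cancelling
  one factor \<open>z\<close> lowers both the number of terms and the order by one.\<close>

lemma polynomial_vanishes_order_eq_0:
  fixes A :: "nat \<Rightarrow> 'a::complex_normed_vector"
  assumes "vanishes_order N (\<lambda>z. \<Sum>n<N. z ^ n *\<^sub>C A n)" "n < N"
  shows "A n = 0"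
  using assms
proof (induction N arbitrary: A n)
  case (Suc N)
  let ?p = "\<lambda>z. \<Sum>n<Suc N. z ^ n *\<^sub>C A n"
  obtain K where K: "K > 0" "\<forall>\<^sub>F z in nhds 0. norm (?p z) \<le> K * norm z ^ Suc N"
    using Suc.prems(1) by (rule vanishes_orderE)
  have "norm (?p 0) \<le> K * norm (0::complex) ^ Suc N"
    using eventually_nhds_x_imp_x[OF K(2)] .
  moreover have "?p 0 = A 0"
    by (subst sum.lessThan_Suc_shift) (simp add: scaleC.zero_left)
  ultimately have A0: "A 0 = 0" by simp
  let ?q = "\<lambda>z. \<Sum>n<N. z ^ n *\<^sub>C A (Suc n)"
  have pq: "?p z = z *\<^sub>C ?q z" for z
    by (subst sum.lessThan_Suc_shift)
      (simp add: A0 scaleC.zero_right scaleC.sum_right scaleC_scaleC)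
  obtain d where d: "d > 0" "\<And>z. norm z < d \<Longrightarrow> norm (?p z) \<le> K * norm z ^ Suc N"
    using K(2) unfolding eventually_nhds_metric by (auto simp: dist_norm)
  have *: "norm (?q z) \<le> K * norm z ^ N" if "z \<noteq> 0" "norm z < d" for z
    using d(2)[OF that(2)] that(1) unfolding pq by (simp add: norm_scaleC)
  have cont: "continuous_on UNIV ?q"
    by (intro continuous_on_sum scaleC.continuous_on continuous_intros)
  \<comment> \<open>Cancelling \<open>z\<close> leaves the origin out; there the estimate follows
    from continuity of both sides.\<close>
  have "norm (?q z) \<le> K * norm z ^ N" if "norm z < d" for z
  proof (cases "z = 0")
    case True
    have "(\<lambda>z. norm (?q z)) \<midarrow>0\<rightarrow> norm (?q 0)"
      using cont by (intro tendsto_norm) (simp add: continuous_on_eq_continuous_at isCont_def)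
    moreover have "(\<lambda>z::complex. K * norm z ^ N) \<midarrow>0\<rightarrow> K * norm (0::complex) ^ N"
      by (intro tendsto_intros)
    moreover have "\<forall>\<^sub>F z in at 0. norm (?q z) \<le> K * norm z ^ N"
      unfolding eventually_at by (rule exI[of _ d]) (use d(1) * in auto)
    ultimately show ?thesis
      unfolding True by (intro tendsto_le[OF at_neq_bot])
  qed (use * that in auto)
  then have "\<forall>\<^sub>F z in nhds 0. norm (?q z) \<le> K * norm z ^ N"
    unfolding eventually_nhds_metric using d(1) by (auto simp: dist_norm)
  then have "vanishes_order N ?q" by (auto simp: vanishes_order_def)
  then have "A (Suc m) = 0" if "m < N" for m
    using that by (rule Suc.IH)
  then show ?case using A0 Suc.prems(2) by (cases n) auto
qed simp

section \<open>Power series with vector coefficients: remainder and uniqueness\<close>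

lemma power_series_terms_bounded:
  fixes U :: "nat \<Rightarrow> 'a::complex_normed_vector"
  assumes "summable (\<lambda>n. z ^ n *\<^sub>C U n)"
  obtains K where "K > 0" "\<And>n. norm (U n) * norm z ^ n \<le> K"
proof -
  have "Bseq (\<lambda>n. z ^ n *\<^sub>C U n)"
    by (rule convergent_imp_Bseq[OF convergentI[OF summable_LIMSEQ_zero[OF assms]]])
  then obtain K where "K > 0" "\<forall>n. norm (z ^ n *\<^sub>C U n) \<le> K"
    by (rule BseqE)
  then show thesis
    by (intro that[of K]) (simp_all add: norm_scaleC norm_power mult.commute)
qed

text \<open>Abel's argument: the terms at \<open>z\<close> are bounded, so those at radius
  \<open>r\<close> are dominated by a geometric series of ratio \<open>r / norm z\<close>.\<close>

lemma power_series_norm_summable: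
  fixes U :: "nat \<Rightarrow> 'a::complex_normed_vector"
  assumes "summable (\<lambda>n. z ^ n *\<^sub>C U n)" "0 \<le> r" "r < norm z"
  shows "summable (\<lambda>n. norm (U n) * r ^ n)"
proof -
  obtain K where K: "K > 0" "\<And>n. norm (U n) * norm z ^ n \<le> K"
    using assms(1) by (rule power_series_terms_bounded) blast
  show ?thesis
  proof (rule summable_comparison_test'[of "\<lambda>n. K * (r / norm z) ^ n" 0])
    show "summable (\<lambda>n. K * (r / norm z) ^ n)"
      using assms by (intro summable_mult summable_geometric) (auto simp: divide_less_eq)
    fix n :: nat
    have "norm (U n) * r ^ n = (norm (U n) * norm z ^ n) * (r / norm z) ^ n"
      using assms by (auto simp: power_divide)
    also have "\<dots> \<le> K * (r / norm z) ^ n"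
      using K(2) assms by (intro mult_right_mono) auto
    finally show "norm (norm (U n) * r ^ n) \<le> K * (r / norm z) ^ n"
      using assms(2) by simp
  qed
qed

text \<open>The tail is \<open>z ^ N\<close> times a series that for \<open>norm z < 1/4\<close> is
  bounded by its sum of norms at \<open>1/4\<close>.\<close>

lemma power_series_remainder:
  fixes U :: "nat \<Rightarrow> 'a::complex_normed_vector"
  assumes "\<And>z. z \<in> ball 0 1 \<Longrightarrow> (\<lambda>n. z ^ n *\<^sub>C U n) sums u z"
  shows "vanishes_order N (\<lambda>z. u z - (\<Sum>n<N. z ^ n *\<^sub>C U n))"
proof -
  \<comment> \<open>Convergence at \<open>1/2\<close> gives absolute convergence at the smaller
    radius \<open>1/4\<close>; any two radii below 1 would do.\<close>
  have "summable (\<lambda>n. (1/2) ^ n *\<^sub>C U n)"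
    using assms[of "1/2"] by (auto simp: sums_iff)
  then have S: "summable (\<lambda>n. norm (U n) * (1/4) ^ n)"
    by (rule power_series_norm_summable) auto
  have S': "summable (\<lambda>n. norm (U (n + N)) * (1/4) ^ n)"
  proof -
    have "summable (\<lambda>n. 4 ^ N * (norm (U (n + N)) * (1/4) ^ (n + N)))"
      using summable_ignore_initial_segment[OF S, of N] by (rule summable_mult)
    then show ?thesis by (simp add: power_add power_divide)
  qed
  define K where "K = (\<Sum>n. norm (U (n + N)) * (1/4) ^ n)"
  have "norm (u z - (\<Sum>n<N. z ^ n *\<^sub>C U n)) \<le> K * norm z ^ N" if z: "norm z < 1/4" for z
  proof -
    have "(\<lambda>n. z ^ (n + N) *\<^sub>C U (n + N)) sums (u z - (\<Sum>n<N. z ^ n *\<^sub>C U n))"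
      using assms[of z] z by (intro sums_split_initial_segment) auto
    then have lim: "(\<lambda>m. \<Sum>n<m. z ^ (n + N) *\<^sub>C U (n + N)) \<longlonglongrightarrow> u z - (\<Sum>n<N. z ^ n *\<^sub>C U n)"
      by (simp add: sums_def)
    have "norm (\<Sum>n<m. z ^ (n + N) *\<^sub>C U (n + N)) \<le> K * norm z ^ N" for m
    proof -
      have "norm (\<Sum>n<m. z ^ (n + N) *\<^sub>C U (n + N)) \<le> (\<Sum>n<m. norm (z ^ (n + N) *\<^sub>C U (n + N)))"
        by (rule norm_sum)
      also have "\<dots> \<le> (\<Sum>n<m. norm (U (n + N)) * (1/4) ^ n * norm z ^ N)"
      proof (rule sum_mono)
        fix n
        have "norm z ^ n \<le> (1/4) ^ n" using z by (intro power_mono) auto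
        then have "norm z ^ n * (norm (U (n + N)) * norm z ^ N) \<le> (1/4) ^ n * (norm (U (n + N)) * norm z ^ N)"
          by (rule mult_right_mono) simp
        then show "norm (z ^ (n + N) *\<^sub>C U (n + N)) \<le> norm (U (n + N)) * (1/4) ^ n * norm z ^ N"
          by (simp add: norm_scaleC norm_power power_add norm_mult algebra_simps)
      qed
      also have "\<dots> = (\<Sum>n<m. norm (U (n + N)) * (1/4) ^ n) * norm z ^ N"
        by (simp add: sum_distrib_right)
      also have "\<dots> \<le> K * norm z ^ N"
        unfolding K_def by (intro mult_right_mono sum_le_suminf[OF S']) auto
      finally show ?thesis .
    qed
    then show ?thesis
      by (intro LIMSEQ_le_const2[OF tendsto_norm[OF lim]]) auto
  qed
  then have "\<forall>\<^sub>F z in nhds 0. norm (u z - (\<Sum>n<N. z ^ n *\<^sub>C U n)) \<le> K * norm z ^ N"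
    unfolding eventually_nhds_metric by (intro exI[of _ "1/4"]) (auto simp: dist_norm)
  then show ?thesis by (auto simp: vanishes_order_def)
qed

text \<open>The difference of the two truncations is a polynomial of degree below \<open>N\<close>
  that vanishes to order \<open>N\<close>. This reduces identities between coefficients to finite
  sums.\<close>

lemma power_series_coeff_eq:
  fixes U A :: "nat \<Rightarrow> 'a::complex_normed_vector"
  assumes "\<And>z. z \<in> ball 0 1 \<Longrightarrow> (\<lambda>n. z ^ n *\<^sub>C U n) sums u z"
    and "vanishes_order N (\<lambda>z. u z - (\<Sum>n<N. z ^ n *\<^sub>C A n))" and "n < N"
  shows "U n = A n"
proof -
  have "vanishes_order N (\<lambda>z. \<Sum>n<N. z ^ n *\<^sub>C (U n - A n))"
    using vanishes_order_diff[OF assms(2) power_series_remainder[OF assms(1)]]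
    by (simp add: scaleC.diff_right sum_subtractf)
  then have "U n - A n = 0"
    using assms(3) by (rule polynomial_vanishes_order_eq_0)
  then show ?thesis by simp
qed

text \<open>Each series agrees with \<open>u\<close> to every order at 0. This is the uniqueness
  behind the \<open>THE\<close> in \<open>disc_coeffs\<close>.\<close>

lemma power_series_unique:
  fixes U V :: "nat \<Rightarrow> 'a::complex_normed_vector"
  assumes "\<And>z. z \<in> ball 0 1 \<Longrightarrow> (\<lambda>n. z ^ n *\<^sub>C U n) sums u z"
    and "\<And>z. z \<in> ball 0 1 \<Longrightarrow> (\<lambda>n. z ^ n *\<^sub>C V n) sums u z"
  shows "U = V"
proof
  fix n
  show "U n = V n"
    using power_series_coeff_eq[OF assms(1) power_series_remainder[OF assms(2)], of n "Suc n"] by simp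
qed

section \<open>Cauchy integrals and the expansion of operator-valued holomorphic functions\<close>

text \<open>Cauchy's formula over the parameter interval. The derivative of
  \<open>circlepath 0 s\<close> is \<open>2 * pi * \<i>\<close> times the path itself, so one power
  in the denominator cancels and \<open>n\<close> replaces \<open>Suc n\<close>.\<close>

lemma has_integral_higher_deriv_circle:
  assumes holF: "F holomorphic_on ball 0 1" and s: "0 < s" "s < 1"
  shows "((\<lambda>t. F (circlepath 0 s t) / circlepath 0 s t ^ n)
    has_integral (deriv ^^ n) F 0 / fact n) {0..1}"
proof -
  have vd: "vector_derivative (circlepath 0 s) (at t) = 2 * pi * \<i> * circlepath 0 s t" for t
    unfolding vector_derivative_circlepath by (simp add: circlepath)
  have "((\<lambda>u. F u / (u - 0) ^ Suc n) has_contour_integral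
      (2 * pi * \<i>) / fact n * (deriv ^^ n) F 0) (circlepath 0 s)"
    using s by (intro Cauchy_has_contour_integral_higher_derivative_circlepath
        holomorphic_on_imp_continuous_on holomorphic_on_subset[OF holF]) auto
  then have "((\<lambda>t. F (circlepath 0 s t) / circlepath 0 s t ^ Suc n * (2 * pi * \<i> * circlepath 0 s t))
      has_integral (2 * pi * \<i>) / fact n * (deriv ^^ n) F 0) {0..1}"
    by (simp only: has_contour_integral vd diff_0_right)
  then have "((\<lambda>t. inverse (2 * pi * \<i>) *
        (F (circlepath 0 s t) / circlepath 0 s t ^ Suc n * (2 * pi * \<i> * circlepath 0 s t)))
      has_integral inverse (2 * pi * \<i>) * ((2 * pi * \<i>) / fact n * (deriv ^^ n) F 0)) {0..1}"
    by (rule has_integral_mult_right)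
  moreover have "inverse (2 * pi * \<i>) *
        (F (circlepath 0 s t) / circlepath 0 s t ^ Suc n * (2 * pi * \<i> * circlepath 0 s t))
      = F (circlepath 0 s t) / circlepath 0 s t ^ n" for t
    using s by (simp add: circlepath field_simps)
  ultimately show ?thesis by (simp add: field_simps)
qed

text \<open>A bounded complex-linear functional commutes with the limit of the difference
  quotients.\<close>

lemma matrix_coeff_holomorphic:
  assumes "u vec_holomorphic_on S"
  shows "(\<lambda>z. matrix_coeff x y (u z)) holomorphic_on S"
  unfolding holomorphic_on_def field_differentiable_def
proof
  fix z assume "z \<in> S"
  then obtain L where "((\<lambda>w. inverse (w - z) *\<^sub>C (u w - u z)) \<longlongrightarrow> L) (at z within S)"
    using assms by (auto simp: vec_holomorphic_on_def)
  then have "((\<lambda>w. matrix_coeff x y (inverse (w - z) *\<^sub>C (u w - u z))) \<longlongrightarrow> matrix_coeff x y L) (at z within S)"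
    by (rule bounded_linear.tendsto[OF bounded_linear_matrix_coeff])
  then show "\<exists>f'. ((\<lambda>z. matrix_coeff x y (u z)) has_field_derivative f') (at z within S)"
    unfolding has_field_derivative_iff
    by (intro exI[of _ "matrix_coeff x y L"])
      (simp add: matrix_coeff_scaleC bounded_linear.linear[OF bounded_linear_matrix_coeff] linear_diff
        divide_inverse mult.commute)
qed

lemma vec_holomorphic_on_imp_continuous_on:
  assumes "u vec_holomorphic_on S"
  shows "continuous_on S u"
  unfolding continuous_on_def
proof
  fix z assume "z \<in> S"
  then obtain L where "((\<lambda>w. inverse (w - z) *\<^sub>C (u w - u z)) \<longlongrightarrow> L) (at z within S)"
    using assms by (auto simp: vec_holomorphic_on_def)
  \<comment> \<open>Multiplying the difference quotient by \<open>w - z\<close>, which tends to 0,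
    recovers the increment of \<open>u\<close>.\<close>
  then have "((\<lambda>w. (w - z) *\<^sub>C (inverse (w - z) *\<^sub>C (u w - u z))) \<longlongrightarrow> (z - z) *\<^sub>C L) (at z within S)"
    by (intro scaleC.tendsto tendsto_intros)
  then have "((\<lambda>w. (w - z) *\<^sub>C (inverse (w - z) *\<^sub>C (u w - u z))) \<longlongrightarrow> 0) (at z within S)"
    by (simp add: scaleC.zero_left)
  then have "((\<lambda>w. u w - u z) \<longlongrightarrow> 0) (at z within S)"
    by (rule Lim_transform_eventually)
      (auto simp: eventually_at_filter scaleC_scaleC)
  then show "(u \<longlongrightarrow> u z) (at z within S)"
    by (simp add: LIM_zero_iff)
qed

text \<open>The coefficients are Cauchy integrals over circles of radius s. They do not depend on s because
  their matrix coefficients are the Taylor coefficients of scalar holomorphic functions.\<close>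

lemma vec_holomorphic_sums_disc_coeffs:
  fixes u :: "complex \<Rightarrow> 'a::real_normed_vector \<Rightarrow>\<^sub>L 'b::complex_hilbert_space"
  assumes u: "u vec_holomorphic_on ball 0 1" and z: "z \<in> ball 0 1"
  shows "(\<lambda>n. z ^ n *\<^sub>C disc_coeffs u n) sums u z"
proof -
  define C where "C s n = integral {0..1} (\<lambda>t. inverse (circlepath 0 s t ^ n) *\<^sub>C u (circlepath 0 s t))"
    for s n
  have circ: "circlepath 0 s t \<noteq> 0" "norm (circlepath 0 s t) = s" if "0 < s" for s t
    using that by (auto simp: circlepath norm_mult)
  have cont_circ: "continuous_on {0..1} (circlepath 0 s)" for s
    using valid_path_imp_path[OF valid_path_circlepath] by (simp add: path_def)
  have cont: "continuous_on {0..1} (\<lambda>t. u (circlepath 0 s t))" if "0 < s" "s < 1" for s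
    using that circ(2)
    by (intro continuous_on_compose2[OF vec_holomorphic_on_imp_continuous_on[OF u] cont_circ]) auto
  have cont': "continuous_on {0..1} (\<lambda>t. inverse (circlepath 0 s t ^ n) *\<^sub>C u (circlepath 0 s t))"
    if "0 < s" "s < 1" for s n
    using that circ(1) by (intro scaleC.continuous_on cont cont_circ that continuous_intros) auto
  have mc: "matrix_coeff x y (C s n) = (deriv ^^ n) (\<lambda>z. matrix_coeff x y (u z)) 0 / fact n"
    if s: "0 < s" "s < 1" for x y s n
  proof -
    have "((\<lambda>t. inverse (circlepath 0 s t ^ n) *\<^sub>C u (circlepath 0 s t)) has_integral C s n) {0..1}"
      unfolding C_def by (intro integrable_integral integrable_continuous_real cont' s)
    then have "((\<lambda>t. matrix_coeff x y (inverse (circlepath 0 s t ^ n) *\<^sub>C u (circlepath 0 s t)))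
        has_integral matrix_coeff x y (C s n)) {0..1}"
      using has_integral_linear[OF _ bounded_linear_matrix_coeff, of _ _ _ x y] by (simp add: o_def)
    then have "((\<lambda>t. matrix_coeff x y (u (circlepath 0 s t)) / circlepath 0 s t ^ n)
        has_integral matrix_coeff x y (C s n)) {0..1}"
      by (simp add: matrix_coeff_scaleC divide_inverse mult.commute)
    then show ?thesis
      using has_integral_higher_deriv_circle[OF matrix_coeff_holomorphic[OF u] s]
      by (rule has_integral_unique)
  qed
  define U where "U = C (1/2)"
  have CU: "C s n = U n" if "0 < s" "s < 1" for s n
    by (rule matrix_coeff_eqI) (simp add: U_def mc that)
  have sums: "(\<lambda>n. z ^ n *\<^sub>C U n) sums u z" if z: "z \<in> ball 0 1" for z
  proof -
    \<comment> \<open>A radius strictly between \<open>norm z\<close> and 1 lets Cauchy's estimate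
      yield the ratio \<open>norm z / s < 1\<close>.\<close>
    obtain s where s: "norm z < s" "s < 1"
      using z dense[of "norm z" 1] by auto
    then have s0: "0 < s" using norm_ge_zero[of z] by linarith
    have "bounded ((\<lambda>t. u (circlepath 0 s t)) ` {0..1})"
      by (intro compact_imp_bounded compact_continuous_image cont s0 s) simp
    then obtain B where B: "\<And>t. t \<in> {0..1} \<Longrightarrow> norm (u (circlepath 0 s t)) \<le> B"
      by (fastforce simp: bounded_iff)
    have U_le: "norm (U n) \<le> B / s ^ n" for n
    proof -
      have "norm (C s n) \<le> B / s ^ n * (1 - 0)"
        unfolding C_def
        using s0 B by (intro integral_bound cont' s)
          (auto simp: norm_scaleC norm_inverse norm_divide norm_power circ(2) field_simps)
      then show ?thesis using CU[OF s0 s(2)] by simp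
    qed
    have "summable (\<lambda>n. z ^ n *\<^sub>C U n)"
    proof (rule summable_comparison_test'[of "\<lambda>n. B * (norm z / s) ^ n" 0])
      show "summable (\<lambda>n. B * (norm z / s) ^ n)"
        using s s0 by (intro summable_mult summable_geometric) auto
      show "norm (z ^ n *\<^sub>C U n) \<le> B * (norm z / s) ^ n" for n
        using mult_left_mono[OF U_le[of n], of "norm z ^ n"]
        by (simp add: norm_scaleC norm_power power_divide mult.commute)
    qed
    then have sm: "(\<lambda>n. z ^ n *\<^sub>C U n) sums (\<Sum>n. z ^ n *\<^sub>C U n)"
      by (rule summable_sums)
    \<comment> \<open>Convergence in norm is settled; the value of the sum is identified weakly,
      through scalar Taylor series.\<close>
    have "(\<Sum>n. z ^ n *\<^sub>C U n) = u z"
    proof (rule matrix_coeff_eqI)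
      fix x y
      have "(\<lambda>n. matrix_coeff x y (z ^ n *\<^sub>C U n)) sums matrix_coeff x y (\<Sum>n. z ^ n *\<^sub>C U n)"
        using sm by (rule bounded_linear.sums[OF bounded_linear_matrix_coeff])
      moreover have "(\<lambda>n. matrix_coeff x y (z ^ n *\<^sub>C U n)) sums matrix_coeff x y (u z)"
        using holomorphic_power_series[OF matrix_coeff_holomorphic[OF u] z, of x y]
        by (simp add: matrix_coeff_scaleC U_def mc mult.commute)
      ultimately show "matrix_coeff x y (\<Sum>n. z ^ n *\<^sub>C U n) = matrix_coeff x y (u z)"
        by (rule sums_unique2)
    qed
    with sm show ?thesis by simp
  qed
  have "disc_coeffs u = U"
    unfolding disc_coeffs_def
    by (rule the_equality) (use sums power_series_unique[of _ u U] in auto)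
  then show ?thesis using sums[OF z] by simp
qed

section \<open>The coefficient estimate and Bohr's inequality\<close>

text \<open>Applying the functional termwise gives a scalar power series, which uniqueness
  identifies with the Taylor series. Circle integrals of \<open>matrix_coeff x y (h z)\<close> thus
  give access to \<open>H n\<close>.\<close>

lemma matrix_coeff_power_series:
  assumes "\<And>z. z \<in> ball 0 1 \<Longrightarrow> (\<lambda>n. z ^ n *\<^sub>C H n) sums h z"
  shows "(\<lambda>z. matrix_coeff x y (h z)) holomorphic_on ball 0 1"
    and "(deriv ^^ n) (\<lambda>z. matrix_coeff x y (h z)) 0 / fact n = matrix_coeff x y (H n)"
proof -
  let ?F = "\<lambda>z. matrix_coeff x y (h z)"
  have sums: "(\<lambda>n. matrix_coeff x y (H n) * z ^ n) sums ?F z" if "z \<in> ball 0 1" for z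
    using bounded_linear.sums[OF bounded_linear_matrix_coeff assms[OF that], of x y]
    by (simp add: matrix_coeff_scaleC mult.commute)
  then show hol: "?F holomorphic_on ball 0 1"
    by (intro power_series_holomorphic[of 0 1 "\<lambda>n. matrix_coeff x y (H n)"]) auto
  have "(\<lambda>n. (deriv ^^ n) ?F 0 / fact n) = (\<lambda>n. matrix_coeff x y (H n))"
    by (rule power_series_unique[of _ ?F])
      (use sums holomorphic_power_series[OF hol] in \<open>simp_all add: scaleC_complex_def mult.commute\<close>)
  then show "(deriv ^^ n) ?F 0 / fact n = matrix_coeff x y (H n)"
    by (rule fun_cong)
qed

text \<open>A rotation cancels the argument of \<open>z\<close>; real parts can then stand for
  moduli.\<close>

lemma unimodular_mult_eq_norm:
  fixes z :: complex
  obtains c where "norm c = 1" "c * z = of_real (norm z)"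
proof (cases "z = 0")
  case False
  have "cnj z / of_real (norm z) * z = of_real ((norm z)\<^sup>2) / of_real (norm z)"
    unfolding complex_norm_square by simp
  then have "cnj z / of_real (norm z) * z = of_real (norm z)"
    by (simp add: power2_eq_square)
  then show thesis
    using False by (intro that[of "cnj z / of_real (norm z)"]) (simp_all add: norm_divide)
qed (use that[of 1] in auto)

text \<open>With \<open>\<sigma> \<alpha> = \<bar>\<alpha>\<bar>\<close> and \<open>u = c (z / s) ^ n\<close>, average the inequality
  \<open>Re (\<sigma> \<langle>x + u y, h z (x + u y)\<rangle>) \<le> M \<parallel>x + u y\<parallel>\<^sup>2\<close> over the circle \<open>\<bar>z\<bar> = s\<close>:
  the diagonal terms give \<open>2 \<bar>\<alpha>\<bar>\<close>, one off-diagonal term gives the coefficient, the other vanishes.\<close>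

lemma power_series_coeff_bound_radius_less:
  fixes h :: "complex \<Rightarrow> 'h::complex_hilbert_space \<Rightarrow>\<^sub>L 'h"
  assumes sums: "\<And>z. z \<in> ball 0 1 \<Longrightarrow> (\<lambda>n. z ^ n *\<^sub>C H n) sums h z"
    and op: "h \<in> ball 0 1 \<rightarrow> bounded_operators"
    and le: "\<And>z. norm z = s \<Longrightarrow> norm (h z) \<le> M"
    and s: "0 < s" "s < 1"
    and H0: "H 0 = \<alpha> *\<^sub>C id_blinfun" and M: "norm \<alpha> \<le> M" and n: "n > 0"
  shows "norm (H n) * s ^ n \<le> 2 * (M - norm \<alpha>)"
proof -
  let ?z = "circlepath 0 s"
  define F where "F x y z = matrix_coeff x y (h z)" for x y z
  note hol = matrix_coeff_power_series[OF sums, folded F_def]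
  have z: "?z t \<noteq> 0" "norm (?z t) = s" for t
    using s by (auto simp: circlepath norm_mult)
  obtain \<sigma> where \<sigma>: "norm \<sigma> = 1" "\<sigma> * \<alpha> = of_real (norm \<alpha>)"
    by (rule unimodular_mult_eq_norm)
  \<comment> \<open>The operator norm is reached through the sesquilinear form on unit
    vectors.\<close>
  have main: "s ^ n * norm (cinner y (blinfun_apply (H n) x)) \<le> 2 * (M - norm \<alpha>)"
    if xy: "norm x = 1" "norm y = 1" for x y
  proof -
    define w where "w = cinner y (blinfun_apply (H n) x)"
    \<comment> \<open>\<open>d\<close> rotates the extracted coefficient to a nonnegative real, so
      that taking real parts loses nothing. \<open>c\<close> is its conjugate because this
      coefficient is accompanied by \<open>cnj (u t)\<close>.\<close>
    obtain d where d: "norm d = 1" "d * (\<sigma> * w) = of_real (norm (\<sigma> * w))"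
      by (rule unimodular_mult_eq_norm)
    define c where "c = cnj d"
    have c: "norm c = 1" "cnj c = d" using d by (auto simp: c_def)
    define u where "u t = c * (?z t / of_real s) ^ n" for t
    have u: "norm (u t) = 1" for t
      using s by (simp add: u_def norm_mult norm_power norm_divide z c(1))
    \<comment> \<open>The conjugate of a unimodular number is its reciprocal:
      \<open>cnj (u t)\<close> carries the power \<open>-n\<close> of the circle point and so
      extracts coefficient \<open>n\<close>, while \<open>u t\<close> carries the power
      \<open>n\<close>.\<close>
    have cu: "cnj (u t) = d * of_real (s ^ n) / ?z t ^ n" for t
    proof -
      have "u t * cnj (u t) = 1"
        using u[of t] by (simp add: complex_norm_square[symmetric] del: of_real_power)
      then have "cnj (u t) = 1 / u t"
        by (metis mult_zero_left nonzero_eq_divide_eq mult.commute zero_neq_one)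
      also have "1 = c * cnj c"
        using c(1) complex_norm_square[of c] by simp
      finally have "cnj (u t) = c * cnj c / u t" .
      then show ?thesis
        using s z(1)[of t] c(1) by (auto simp: u_def c(2) field_simps power_divide)
    qed
    \<comment> \<open>The two sides of the inequality to be averaged, arranged so that Cauchy's
      formula integrates every nonconstant term.\<close>
    let ?L = "\<lambda>t. \<sigma> * (F x x (?z t) + F y y (?z t) + d * of_real (s ^ n) * (F x y (?z t) / ?z t ^ n)
        + c / of_real (s ^ n) * (?z t ^ n * F y x (?z t)))"
    let ?R = "\<lambda>t. M * 2 + 2 * M * (c / of_real (s ^ n) * (?z t ^ n * cinner x y))"
    have Re_affine: "M * (2 + 2 * Re w) = Re (of_real (M * 2) + of_real (2 * M) * w)" for w
      by (simp add: algebra_simps)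
    have ineq: "Re (?L t) \<le> Re (?R t)" for t
    proof -
      let ?v = "x + u t *\<^sub>C y"
      have lin: "blinfun_apply (h (?z t)) ?v = blinfun_apply (h (?z t)) x + u t *\<^sub>C blinfun_apply (h (?z t)) y"
        using op z(2)[of t] s by (auto simp: blinfun.add_right bounded_operators_def Pi_iff)
      have "cinner ?v (blinfun_apply (h (?z t)) ?v)
        = F x x (?z t) + (cnj (u t) * u t) * F y y (?z t) + cnj (u t) * F x y (?z t) + u t * F y x (?z t)"
        unfolding lin F_def matrix_coeff_def
        by (simp add: cinner_add_left cinner_add_right cinner_scaleC_left cinner_scaleC_right algebra_simps)
      also have "cnj (u t) * u t = 1"
        using u[of t] by (simp add: complex_norm_square[symmetric] mult.commute del: of_real_power)
      finally have "\<sigma> * cinner ?v (blinfun_apply (h (?z t)) ?v) = ?L t"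
        unfolding cu by (simp add: u_def power_divide field_simps)
      then have "Re (?L t) \<le> norm (\<sigma> * cinner ?v (blinfun_apply (h (?z t)) ?v))"
        by (metis complex_Re_le_cmod)
      also have "\<dots> = norm (cinner ?v (blinfun_apply (h (?z t)) ?v))"
        by (simp add: norm_mult \<sigma>)
      also have "\<dots> \<le> norm ?v * norm (blinfun_apply (h (?z t)) ?v)"
        by (rule norm_cinner_le)
      also have "\<dots> \<le> norm ?v * (norm (h (?z t)) * norm ?v)"
        by (intro mult_left_mono norm_blinfun) auto
      also have "\<dots> \<le> norm ?v * (M * norm ?v)"
        by (intro mult_left_mono mult_right_mono le z) auto
      also have "\<dots> = M * (norm ?v)\<^sup>2"
        by (simp add: power2_eq_square)
      also have "(norm ?v)\<^sup>2 = 2 + 2 * Re (u t * cinner x y)"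
        by (simp add: norm_add_squared xy norm_scaleC u cinner_scaleC_right)
      also have "M * \<dots> = Re (of_real (M * 2) + of_real (2 * M) * (u t * cinner x y))"
        by (rule Re_affine)
      also have "\<dots> = Re (?R t)"
        by (rule arg_cong[of _ _ Re]) (simp add: u_def power_divide)
      finally show ?thesis .
    qed
    have c0: "cinner a (blinfun_apply (H 0) a) = \<alpha>" if "norm a = 1" for a
      using that by (simp add: H0 scaleC_blinfun.rep_eq cinner_scaleC_right cinner_self)
    \<comment> \<open>The mean value property, which is the case \<open>n = 0\<close> of Cauchy's
      formula.\<close>
    have I0: "((\<lambda>t. G (?z t)) has_integral G 0) {0..1}" if "G holomorphic_on ball 0 1" for G
      using has_integral_higher_deriv_circle[OF that s, of 0] by simp
    have Ixx: "((\<lambda>t. F a a (?z t)) has_integral \<alpha>) {0..1}" if "norm a = 1" for a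
      using I0[OF hol(1)[where x = a and y = a]] hol(2)[where n = 0 and x = a and y = a] c0[OF that] by (simp add: matrix_coeff_def)
    have Ixy: "((\<lambda>t. F x y (?z t) / ?z t ^ n) has_integral w) {0..1}"
      using has_integral_higher_deriv_circle[OF hol(1)[where x = x and y = y] s, of n]
        hol(2)[where n = n and x = x and y = y]
      by (simp add: matrix_coeff_def w_def)
    \<comment> \<open>As \<open>n > 0\<close>, the factor \<open>z ^ n\<close> makes the averaged
      function vanish at the centre; \<open>Ic\<close> rests on the same remark.\<close>
    have Iyx: "((\<lambda>t. ?z t ^ n * F y x (?z t)) has_integral 0) {0..1}"
      using I0[of "\<lambda>z. z ^ n * F y x z", OF holomorphic_on_mult[OF holomorphic_on_power[OF holomorphic_on_ident] hol(1)]] n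
      by (simp add: power_0_left)
    have Ic: "((\<lambda>t. ?z t ^ n * cinner x y) has_integral 0) {0..1}"
      using I0[of "\<lambda>z. z ^ n * cinner x y", OF holomorphic_on_mult[OF holomorphic_on_power[OF holomorphic_on_ident] holomorphic_on_const]] n
      by (simp add: power_0_left)
    have IL: "(?L has_integral \<sigma> * (\<alpha> + \<alpha> + d * of_real (s ^ n) * w + c / of_real (s ^ n) * 0)) {0..1}"
      by (intro has_integral_mult_right has_integral_add Ixx Ixy Iyx xy)
    have IR: "(?R has_integral M * 2 + 2 * M * (c / of_real (s ^ n) * 0)) {0..1}"
      using has_integral_const_real[of "of_real M * 2 :: complex" 0 1]
      by (intro has_integral_mult_right has_integral_add Ic) simp
    have le: "Re (\<sigma> * (\<alpha> + \<alpha> + d * of_real (s ^ n) * w + c / of_real (s ^ n) * 0))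
        \<le> Re (M * 2 + 2 * M * (c / of_real (s ^ n) * 0))"
      using has_integral_Re[OF IL] has_integral_Re[OF IR] ineq by (rule has_integral_le)
    have "\<sigma> * (\<alpha> + \<alpha> + d * of_real (s ^ n) * w + c / of_real (s ^ n) * 0)
        = 2 * (\<sigma> * \<alpha>) + of_real (s ^ n) * (d * (\<sigma> * w))"
      by (simp add: algebra_simps)
    also have "\<dots> = of_real (2 * norm \<alpha> + s ^ n * norm w)"
      unfolding \<sigma>(2) d(2) by (simp add: norm_mult \<sigma>(1))
    finally show ?thesis
      using le by (simp add: w_def del: of_real_add of_real_mult)
  qed
  have "norm (H n) \<le> 2 * (M - norm \<alpha>) / s ^ n"
  proof (rule norm_blinfun_bound)
    show "0 \<le> 2 * (M - norm \<alpha>) / s ^ n" using M s by simp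
    fix x :: 'h
    let ?y = "blinfun_apply (H n) x"
    show "norm ?y \<le> 2 * (M - norm \<alpha>) / s ^ n * norm x"
    proof (cases "?y = 0")
      case True
      then show ?thesis using M s by simp
    next
      case False
      then have x: "x \<noteq> 0" by (auto simp: blinfun.zero_right)
      \<comment> \<open>Against the normalised image the form takes the value
        \<open>norm ?y / norm x\<close>.\<close>
      let ?p = "inverse (norm x) *\<^sub>R x" and ?q = "inverse (norm ?y) *\<^sub>R ?y"
      have "s ^ n * norm (cinner ?q (blinfun_apply (H n) ?p)) \<le> 2 * (M - norm \<alpha>)"
        using x False by (intro main) auto
      also have "cinner ?q (blinfun_apply (H n) ?p) = inverse (norm ?y) * (inverse (norm x) * (norm ?y)\<^sup>2)"
        unfolding blinfun.scaleR_right
        by (simp add: scaleC_of_real[symmetric] cinner_scaleC_left cinner_scaleC_right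
            cinner_self del: of_real_inverse)
      also have "\<dots> = of_real (norm ?y / norm x)"
        using False by (simp add: power2_eq_square field_simps)
      finally show ?thesis
        using s x by (simp add: norm_divide field_simps)
    qed
  qed
  then show ?thesis using s by (simp add: field_simps)
qed

text \<open>The estimate on circles passes to the limit as \<open>s\<close> tends to
  \<open>\<beta>\<close> from the left, since \<open>h\<close> is controlled only on the open disc
  of radius \<open>\<beta>\<close>.\<close>

lemma power_series_coeff_bound:
  fixes h :: "complex \<Rightarrow> 'h::complex_hilbert_space \<Rightarrow>\<^sub>L 'h"
  assumes sums: "\<And>z. z \<in> ball 0 1 \<Longrightarrow> (\<lambda>n. z ^ n *\<^sub>C H n) sums h z"
    and op: "h \<in> ball 0 1 \<rightarrow> bounded_operators"
    and le: "\<And>z. norm z < \<beta> \<Longrightarrow> norm (h z) \<le> M" and \<beta>: "0 < \<beta>" "\<beta> \<le> 1"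
    and H0: "H 0 = \<alpha> *\<^sub>C id_blinfun" and M: "norm \<alpha> \<le> M" and n: "n > 0"
  shows "norm (H n) * \<beta> ^ n \<le> 2 * (M - norm \<alpha>)"
proof -
  have "((\<lambda>s. norm (H n) * s ^ n) \<longlongrightarrow> norm (H n) * \<beta> ^ n) (at_left \<beta>)"
    by (intro tendsto_intros)
  moreover have "\<forall>\<^sub>F s in at_left \<beta>. norm (H n) * s ^ n \<le> 2 * (M - norm \<alpha>)"
    using eventually_at_left_real[OF \<beta>(1)]
  proof eventually_elim
    case (elim s)
    then show ?case
      using \<beta> by (intro power_series_coeff_bound_radius_less[OF sums op le _ _ H0 M n]) auto
  qed
  ultimately show ?thesis
    by (rule tendsto_upperbound) simp
qed

text \<open>The form with partial sums fits the finite sums of products to which the inequality is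
  applied.\<close>

lemma bohr_inequality_partial_sum:
  fixes h :: "complex \<Rightarrow> 'h::complex_hilbert_space \<Rightarrow>\<^sub>L 'h"
  assumes sums: "\<And>z. z \<in> ball 0 1 \<Longrightarrow> (\<lambda>n. z ^ n *\<^sub>C H n) sums h z"
    and op: "h \<in> ball 0 1 \<rightarrow> bounded_operators"
    and le: "\<And>z. norm z < \<beta> \<Longrightarrow> norm (h z) \<le> M" and \<beta>: "\<beta> \<le> 1"
    and H0: "H 0 = \<alpha> *\<^sub>C id_blinfun" and M: "norm \<alpha> \<le> M"
    and r: "0 \<le> r" "r \<le> \<beta> / 3"
  shows "(\<Sum>n<N. norm (H n) * r ^ n) \<le> M"
proof -
  have M0: "M \<ge> 0" using M norm_ge_zero[of \<alpha>] by linarith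
  \<comment> \<open>Only an inequality, because the identity has norm 0 on the trivial
    space.\<close>
  have "norm (id_blinfun :: 'h \<Rightarrow>\<^sub>L 'h) \<le> 1"
    by (rule norm_blinfun_bound) auto
  then have H0_le: "norm (H 0) \<le> norm \<alpha>"
    using mult_left_mono[of "norm (id_blinfun :: 'h \<Rightarrow>\<^sub>L 'h)" 1 "norm \<alpha>"] by (simp add: H0 norm_scaleC)
  have term_le: "norm (H (Suc n)) * r ^ Suc n \<le> 2 * (M - norm \<alpha>) * (1/3) ^ Suc n" for n
  proof (cases "r = 0")
    \<comment> \<open>Here \<open>\<beta>\<close> may be 0, where the coefficient estimate does not
      apply; the term vanishes because its exponent is \<open>Suc n\<close>.\<close>
    case True
    then show ?thesis using M by simp
  next
    case False
    then have \<beta>0: "\<beta> > 0" using r by linarith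
    have "norm (H (Suc n)) * r ^ Suc n \<le> norm (H (Suc n)) * (\<beta> / 3) ^ Suc n"
      using r by (intro mult_left_mono power_mono) auto
    also have "\<dots> = norm (H (Suc n)) * \<beta> ^ Suc n * (1/3) ^ Suc n"
      unfolding power_divide by simp
    also have "\<dots> \<le> 2 * (M - norm \<alpha>) * (1/3) ^ Suc n"
      by (intro mult_right_mono power_series_coeff_bound[OF sums op le \<beta>0 \<beta> H0 M]) auto
    finally show ?thesis .
  qed
  have geom: "(\<Sum>n<m. (1/3::real) ^ Suc n) = (1 - (1/3) ^ m) / 2" for m
    by (induction m) (simp_all add: diff_divide_distrib)
  show ?thesis
  proof (cases N)
    case (Suc m)
    have "(\<Sum>n<N. norm (H n) * r ^ n) = norm (H 0) + (\<Sum>n<m. norm (H (Suc n)) * r ^ Suc n)"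
      unfolding Suc by (subst sum.lessThan_Suc_shift) simp
    also have "\<dots> \<le> norm \<alpha> + (\<Sum>n<m. 2 * (M - norm \<alpha>) * (1/3) ^ Suc n)"
      by (intro add_mono H0_le sum_mono term_le)
    also have "\<dots> = norm \<alpha> + (M - norm \<alpha>) * (1 - (1/3) ^ m)"
      unfolding sum_distrib_left[symmetric] geom by simp
    also have "\<dots> \<le> norm \<alpha> + (M - norm \<alpha>) * 1"
      using M by (intro add_left_mono mult_left_mono) auto
    finally show ?thesis by simp
  qed (use M0 in simp)
qed

text \<open>The operator inequality is applied to \<open>\<psi> z\<close> times the identity of the
  one-dimensional space \<open>complex\<close>, with \<open>\<alpha> = \<psi> 0\<close> and
  \<open>M = \<beta> = 1\<close>.\<close>

lemma scalar_bohr_inequality_partial_sum: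
  assumes hol: "\<psi> holomorphic_on ball 0 1"
    and le: "\<And>z. norm z < 1 \<Longrightarrow> norm (\<psi> z) \<le> 1" and r: "0 \<le> r" "r \<le> 1 / 3"
  shows "(\<Sum>n<N. norm ((deriv ^^ n) \<psi> 0 / fact n) * r ^ n) \<le> 1"
proof -
  let ?a = "\<lambda>n. (deriv ^^ n) \<psi> 0 / fact n"
  let ?I = "id_blinfun :: complex \<Rightarrow>\<^sub>L complex"
  have "(\<Sum>n<N. norm (?a n *\<^sub>C ?I) * r ^ n) \<le> 1"
  proof (rule bohr_inequality_partial_sum[where \<beta> = 1])
    fix z :: complex assume z: "z \<in> ball 0 1"
    have "(\<lambda>n. (?a n * z ^ n) *\<^sub>C ?I) sums (\<psi> z *\<^sub>C ?I)"
      using holomorphic_power_series[OF hol z] by (intro bounded_linear.sums[OF scaleC.bounded_linear_left]) simp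
    then show "(\<lambda>n. z ^ n *\<^sub>C (?a n *\<^sub>C ?I)) sums (\<psi> z *\<^sub>C ?I)"
      by (simp add: scaleC_scaleC mult.commute)
  next
    show "(\<lambda>z. \<psi> z *\<^sub>C ?I) \<in> ball 0 1 \<rightarrow> bounded_operators"
      by (auto simp: bounded_operators_def scaleC_blinfun.rep_eq scaleC_scaleC mult.commute)
    show "norm (\<psi> z *\<^sub>C ?I) \<le> 1" if "norm z < 1" for z
      using le[OF that] by (simp add: norm_scaleC)
    show "norm (?a 0) \<le> 1" using le[of 0] by simp
  qed (use r in auto)
  then show ?thesis by (simp add: norm_scaleC)
qed

section \<open>The Schwarz quotient and the coefficients of the composition\<close>

lemma Schwarz_quotient:
  assumes "\<phi> \<in> ball 0 1 \<rightarrow> ball 0 1" "\<phi> holomorphic_on ball 0 1" "\<phi> 0 = 0"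
  obtains \<psi> where "\<psi> holomorphic_on ball 0 1" "\<And>z. norm z < 1 \<Longrightarrow> \<phi> z = z * \<psi> z"
    "\<And>z. norm z < 1 \<Longrightarrow> norm (\<psi> z) \<le> 1"
proof -
  obtain \<psi> where \<psi>: "\<psi> holomorphic_on ball 0 1" "\<And>z. norm z < 1 \<Longrightarrow> \<phi> z = z * \<psi> z" "deriv \<phi> 0 = \<psi> 0"
    using Schwarz3[OF assms(2,3)] by blast
  have lt: "norm (\<phi> z) < 1" if "norm z < 1" for z
    using assms(1) that by auto
  have "norm (\<psi> z) \<le> 1" if z: "norm z < 1" for z
  proof (cases "z = 0")
    case True
    then show ?thesis using Schwarz_Lemma(2)[OF assms(2,3) lt z] \<psi>(3) by simp
  next
    case False
    then show ?thesis using Schwarz_Lemma(1)[OF assms(2,3) lt z] \<psi>(2)[OF z] by (simp add: norm_mult)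
  qed
  with \<psi>(1,2) show thesis by (rule that)
qed

text \<open>Monomials of degree at least \<open>N\<close> are negligible, and the others are grouped
  by degree. The index type is arbitrary so that \<open>d\<close> can be the total degree of a
  triple.\<close>

lemma polynomial_vanishes_order_truncate:
  fixes A :: "'i \<Rightarrow> 'a::complex_normed_vector"
  assumes "finite T"
  shows "vanishes_order N (\<lambda>z. (\<Sum>t\<in>T. z ^ d t *\<^sub>C A t) - (\<Sum>n<N. z ^ n *\<^sub>C (\<Sum>t | t \<in> T \<and> d t = n. A t)))"
proof -
  have low: "(\<Sum>n<N. z ^ n *\<^sub>C (\<Sum>t | t \<in> T \<and> d t = n. A t)) = (\<Sum>t | t \<in> T \<and> d t < N. z ^ d t *\<^sub>C A t)" for z
  proof -
    have "(\<Sum>n<N. z ^ n *\<^sub>C (\<Sum>t | t \<in> T \<and> d t = n. A t))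
        = (\<Sum>n<N. \<Sum>t | t \<in> {t \<in> T. d t < N} \<and> d t = n. z ^ d t *\<^sub>C A t)"
      by (intro sum.cong refl) (auto simp: scaleC.sum_right intro!: sum.cong)
    also have "\<dots> = (\<Sum>t | t \<in> T \<and> d t < N. z ^ d t *\<^sub>C A t)"
      using assms by (intro sum.group) auto
    finally show ?thesis .
  qed
  have "(\<Sum>t\<in>T. z ^ d t *\<^sub>C A t) - (\<Sum>t | t \<in> T \<and> d t < N. z ^ d t *\<^sub>C A t)
      = (\<Sum>t\<in>T - {t \<in> T. d t < N}. z ^ d t *\<^sub>C A t)" for z
    using assms by (subst sum_diff) auto
  moreover have "vanishes_order N (\<lambda>z. \<Sum>t\<in>T - {t \<in> T. d t < N}. z ^ d t *\<^sub>C A t)"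
    by (intro vanishes_order_sum vanishes_order_mono[OF vanishes_order_monomial]) auto
  ultimately show ?thesis unfolding low by simp
qed

text \<open>Complex linearity of \<open>T\<close> is the identity
  \<open>T o\<^sub>L (c *\<^sub>C id_blinfun) = c *\<^sub>C T\<close>. Both sides are bounded linear
  in \<open>T\<close>, so it passes from the values of \<open>h\<close> to the coefficients by
  uniqueness.\<close>

lemma power_series_coeff_bounded_operator:
  assumes H: "\<And>z. z \<in> ball 0 1 \<Longrightarrow> (\<lambda>n. z ^ n *\<^sub>C H n) sums h z"
    and h: "h \<in> ball 0 1 \<rightarrow> bounded_operators"
  shows "H n \<in> bounded_operators"
proof -
  have "H n o\<^sub>L (c *\<^sub>C id_blinfun) = c *\<^sub>C H n" for c
  proof -
    have "(\<lambda>n. H n o\<^sub>L (c *\<^sub>C id_blinfun)) = (\<lambda>n. c *\<^sub>C H n)"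
    proof (rule power_series_unique[of _ "\<lambda>z. h z o\<^sub>L (c *\<^sub>C id_blinfun)"])
      fix z :: complex assume z: "z \<in> ball 0 1"
      have "h z o\<^sub>L (c *\<^sub>C id_blinfun) = c *\<^sub>C h z"
        using funcset_mem[OF h z] by (intro blinfun_eqI) (simp add: scaleC_blinfun.rep_eq bounded_operators_def)
      then show "(\<lambda>n. z ^ n *\<^sub>C (c *\<^sub>C H n)) sums (h z o\<^sub>L (c *\<^sub>C id_blinfun))"
        using bounded_linear.sums[OF scaleC.bounded_linear_right H[OF z], of c] by (simp add: scaleC_scaleC mult.commute)
      have "(\<lambda>n. (z ^ n *\<^sub>C H n) o\<^sub>L (c *\<^sub>C id_blinfun)) sums (h z o\<^sub>L (c *\<^sub>C id_blinfun))"
        by (rule bounded_linear.sums[OF bounded_bilinear.bounded_linear_left[OF bounded_bilinear_blinfun_compose] H[OF z]])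
      moreover have "(z ^ n *\<^sub>C H n) o\<^sub>L (c *\<^sub>C id_blinfun) = z ^ n *\<^sub>C (H n o\<^sub>L (c *\<^sub>C id_blinfun))" for n
        by (intro blinfun_eqI) (simp add: scaleC_blinfun.rep_eq)
      ultimately show "(\<lambda>n. z ^ n *\<^sub>C (H n o\<^sub>L (c *\<^sub>C id_blinfun))) sums (h z o\<^sub>L (c *\<^sub>C id_blinfun))"
        by simp
    qed
    then show ?thesis by (rule fun_cong)
  qed
  from arg_cong[OF this, of blinfun_apply] show ?thesis
    by (auto simp: bounded_operators_def scaleC_blinfun.rep_eq fun_eq_iff)
qed

text \<open>Everything is compared modulo terms of order N at 0, so that only finite sums occur.\<close>

lemma composition_coeffs:
  fixes f g h :: "complex \<Rightarrow> 'h::complex_hilbert_space \<Rightarrow>\<^sub>L 'h"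
  assumes F: "\<And>z. z \<in> ball 0 1 \<Longrightarrow> (\<lambda>n. z ^ n *\<^sub>C F n) sums f z"
    and G: "\<And>z. z \<in> ball 0 1 \<Longrightarrow> (\<lambda>n. z ^ n *\<^sub>C G n) sums g z"
    and H: "\<And>z. z \<in> ball 0 1 \<Longrightarrow> (\<lambda>n. z ^ n *\<^sub>C H n) sums h z"
    and h_op: "h \<in> ball 0 1 \<rightarrow> bounded_operators"
    and P: "\<And>k z. z \<in> ball 0 1 \<Longrightarrow> (\<lambda>n. p k n * z ^ n) sums (\<psi> z ^ k)"
    and \<phi>: "\<And>z. z \<in> ball 0 1 \<Longrightarrow> \<phi> z = z * \<psi> z" "\<And>z. z \<in> ball 0 1 \<Longrightarrow> norm (\<psi> z) \<le> 1"
    and f: "\<And>z. z \<in> ball 0 1 \<Longrightarrow> f z = h z o\<^sub>L g (\<phi> z)"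
    and "n < N"
  shows "F n = (\<Sum>(i, k, j) | (i, k, j) \<in> {..<N} \<times> {..<N} \<times> {..<N} \<and> i + (k + j) = n. p k j *\<^sub>C (H i o\<^sub>L G k))"
proof -
  \<comment> \<open>Three truncations: of \<open>h\<close>, of \<open>g\<close> at
    \<open>\<phi> z\<close>, and then of each power of \<open>\<psi>\<close>.\<close>
  define h' where "h' z = (\<Sum>i<N. z ^ i *\<^sub>C H i)" for z
  define g' where "g' z = (\<Sum>k<N. \<phi> z ^ k *\<^sub>C G k)" for z
  define g'' where "g'' z = (\<Sum>k<N. z ^ k *\<^sub>C ((\<Sum>j<N. z ^ j *\<^sub>C p k j) *\<^sub>C G k))" for z
  have ball: "\<forall>\<^sub>F z::complex in nhds 0. z \<in> ball 0 1"
    by (rule eventually_nhds_in_open) auto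
  have \<phi>_le: "\<forall>\<^sub>F z in nhds 0. norm (\<phi> z) \<le> norm z"
    using ball
  proof eventually_elim
    case (elim z)
    then show ?case using \<phi>[of z] mult_left_le[of "norm (\<psi> z)" "norm z"] by (simp add: norm_mult)
  qed
  \<comment> \<open>Order 0 is boundedness near 0, as required of a factor multiplying a negligible
    difference.\<close>
  have const: "vanishes_order 0 h'"
    unfolding h'_def by (intro vanishes_order_sum vanishes_order_mono[OF vanishes_order_monomial]) auto
  have g0: "vanishes_order 0 (\<lambda>z. g (\<phi> z))"
    using power_series_remainder[OF G, of 0] by (intro vanishes_order_compose[OF _ \<phi>_le]) simp
  have hh': "vanishes_order N (\<lambda>z. h z - h' z)"
    unfolding h'_def using H by (rule power_series_remainder)
  have gg': "vanishes_order N (\<lambda>z. g (\<phi> z) - g' z)"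
    unfolding g'_def by (intro vanishes_order_compose[OF power_series_remainder[OF G] \<phi>_le])
  have "vanishes_order N (\<lambda>z. (\<psi> z ^ k - (\<Sum>j<N. z ^ j *\<^sub>C p k j)) *\<^sub>C G k)" for k
  proof -
    have "vanishes_order N (\<lambda>z. \<psi> z ^ k - (\<Sum>j<N. z ^ j *\<^sub>C p k j))"
      by (rule power_series_remainder) (use P in \<open>simp add: scaleC_complex_def mult.commute\<close>)
    from vanishes_order_bilinear[OF bounded_bilinear_scaleC this vanishes_order_const]
    show ?thesis by simp
  qed
  \<comment> \<open>The factor \<open>z ^ k\<close> only raises the order to \<open>k + N\<close>,
    so order \<open>N\<close> is retained for every \<open>k\<close>.\<close>
  from vanishes_order_bilinear[OF bounded_bilinear_scaleC vanishes_order_power this]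
  have "vanishes_order N (\<lambda>z. \<Sum>k<N. z ^ k *\<^sub>C ((\<psi> z ^ k - (\<Sum>j<N. z ^ j *\<^sub>C p k j)) *\<^sub>C G k))"
    by (intro vanishes_order_sum) (rule vanishes_order_mono, assumption, simp)
  then have g'g'': "vanishes_order N (\<lambda>z. g' z - g'' z)"
  proof (rule vanishes_order_cong[rotated])
    show "\<forall>\<^sub>F z in nhds 0. (\<Sum>k<N. z ^ k *\<^sub>C ((\<psi> z ^ k - (\<Sum>j<N. z ^ j *\<^sub>C p k j)) *\<^sub>C G k)) = g' z - g'' z"
      using ball
      by eventually_elim (simp add: g'_def g''_def \<phi> scaleC.diff_left scaleC.diff_right
          sum_subtractf scaleC_scaleC power_mult_distrib)
  qed
  have "vanishes_order N (\<lambda>z. g (\<phi> z) - g'' z)"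
    using vanishes_order_add[OF gg' g'g''] by simp
  from vanishes_order_bilinear[OF bounded_bilinear_blinfun_compose const this]
  have 1: "vanishes_order N (\<lambda>z. h' z o\<^sub>L (g (\<phi> z) - g'' z))" by simp
  from vanishes_order_bilinear[OF bounded_bilinear_blinfun_compose hh' g0]
  have 2: "vanishes_order N (\<lambda>z. (h z - h' z) o\<^sub>L g (\<phi> z))" by simp
  \<comment> \<open>Telescoping: the factors of the product are replaced one at a time.\<close>
  have fg: "vanishes_order N (\<lambda>z. f z - (h' z o\<^sub>L g'' z))"
  proof (rule vanishes_order_cong[OF _ vanishes_order_add[OF 1 2]])
    show "\<forall>\<^sub>F z in nhds 0. (h' z o\<^sub>L (g (\<phi> z) - g'' z)) + ((h z - h' z) o\<^sub>L g (\<phi> z)) = f z - (h' z o\<^sub>L g'' z)"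
      using ball
      by eventually_elim
        (simp add: f bounded_bilinear.diff_left[OF bounded_bilinear_blinfun_compose]
          bounded_bilinear.diff_right[OF bounded_bilinear_blinfun_compose])
  qed
  let ?T = "{..<N} \<times> {..<N} \<times> {..<N}"
  let ?A = "\<lambda>(i, k, j). p k j *\<^sub>C (H i o\<^sub>L G k)" and ?d = "\<lambda>(i, k, j). i + (k + j)"
  have expand: "h' z o\<^sub>L g'' z = (\<Sum>t\<in>?T. z ^ ?d t *\<^sub>C ?A t)" for z
  proof -
    \<comment> \<open>Complex linearity of \<open>H i\<close> lets \<open>b\<close> move out of the
      right factor.\<close>
    have comp: "(a *\<^sub>C H i) o\<^sub>L (b *\<^sub>C T) = (a * b) *\<^sub>C (H i o\<^sub>L T)"
      for a b i and T :: "'h \<Rightarrow>\<^sub>L 'h"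
      using power_series_coeff_bounded_operator[OF H h_op, of i]
      by (intro blinfun_eqI) (simp add: scaleC_blinfun.rep_eq bounded_operators_def scaleC_scaleC algebra_simps)
    have "h' z o\<^sub>L g'' z = (\<Sum>i<N. (z ^ i *\<^sub>C H i) o\<^sub>L g'' z)"
      unfolding h'_def by (rule bounded_bilinear.sum_left[OF bounded_bilinear_blinfun_compose])
    also have "\<dots> = (\<Sum>i<N. \<Sum>k<N. \<Sum>j<N. (z ^ i *\<^sub>C H i) o\<^sub>L (z ^ k *\<^sub>C ((z ^ j *\<^sub>C p k j) *\<^sub>C G k)))"
      by (simp add: g''_def scaleC.sum_left scaleC.sum_right
          bounded_bilinear.sum_right[OF bounded_bilinear_blinfun_compose])
    also have "\<dots> = (\<Sum>i<N. \<Sum>k<N. \<Sum>j<N. z ^ (i + (k + j)) *\<^sub>C (p k j *\<^sub>C (H i o\<^sub>L G k)))"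
      by (simp add: comp scaleC_scaleC scaleC_complex_def power_add mult_ac)
    finally show ?thesis
      by (simp add: sum.cartesian_product case_prod_unfold)
  qed
  have "vanishes_order N (\<lambda>z. f z - (\<Sum>n<N. z ^ n *\<^sub>C (\<Sum>t | t \<in> ?T \<and> ?d t = n. ?A t)))"
    using vanishes_order_add[OF fg[unfolded expand] polynomial_vanishes_order_truncate[of ?T N ?d ?A]] by simp
  from power_series_coeff_eq[OF F this \<open>n < N\<close>]
  have "F n = (\<Sum>t | t \<in> ?T \<and> ?d t = n. ?A t)" .
  then show ?thesis
    by (simp add: case_prod_unfold mem_Times_iff)
qed

section \<open>The majorant estimate for the composition\<close>

theorem theorem2p2:
  fixes f g h :: "complex \<Rightarrow> ('h::complex_hilbert_space \<Rightarrow>\<^sub>L 'h)"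
    and \<phi> :: "complex \<Rightarrow> complex"
    and \<alpha> :: complex
    and M \<beta> r :: real
  assumes "f \<in> ball 0 1 \<rightarrow> bounded_operators" and "f vec_holomorphic_on ball 0 1"
    and "g \<in> ball 0 1 \<rightarrow> bounded_operators" and "g vec_holomorphic_on ball 0 1"
    and "h \<in> ball 0 1 \<rightarrow> bounded_operators" and "h vec_holomorphic_on ball 0 1"
    and "\<phi> \<in> ball 0 1 \<rightarrow> ball 0 1" and "\<phi> holomorphic_on ball 0 1" and "\<phi> 0 = 0"
    and "\<And>z. z \<in> ball 0 1 \<Longrightarrow> f z = h z o\<^sub>L g (\<phi> z)"
    and "\<beta> \<le> 1" and "\<And>z. norm z < \<beta> \<Longrightarrow> norm (h z) \<le> M"
    and "h 0 = \<alpha> *\<^sub>C id_blinfun" and "norm \<alpha> \<le> M"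
    and "0 \<le> r" and "r \<le> \<beta> / 3"
  shows "bohr_operator r f \<le> M * bohr_operator r g"
proof -
  define F G H where "F = disc_coeffs f" "G = disc_coeffs g" "H = disc_coeffs h"
  have F: "(\<lambda>n. z ^ n *\<^sub>C F n) sums f z" and G: "(\<lambda>n. z ^ n *\<^sub>C G n) sums g z"
    and H: "(\<lambda>n. z ^ n *\<^sub>C H n) sums h z" if "z \<in> ball 0 1" for z
    unfolding F_G_H_def
    by (rule vec_holomorphic_sums_disc_coeffs[OF assms(2) that],
        rule vec_holomorphic_sums_disc_coeffs[OF assms(4) that],
        rule vec_holomorphic_sums_disc_coeffs[OF assms(6) that])
  have H0: "H 0 = \<alpha> *\<^sub>C id_blinfun"
  proof -
    \<comment> \<open>At the origin only the term \<open>n = 0\<close> survives, as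
      \<open>0 ^ 0 = 1\<close>.\<close>
    have "(\<lambda>n. 0 ^ n *\<^sub>C H n) sums (\<Sum>n\<in>{0}. 0 ^ n *\<^sub>C H n)"
      by (rule sums_finite) (auto simp: power_0_left scaleC.zero_left)
    then show ?thesis
      using sums_unique2[OF H[of 0]] assms(13) by simp
  qed
  \<comment> \<open>Since \<open>\<beta> \<le> 1\<close>, the same \<open>r\<close> is admissible
    for the powers of \<open>\<psi>\<close> on the whole unit disc.\<close>
  have r: "r \<le> 1 / 3" using assms by linarith
  have M: "M \<ge> 0" using assms(14) norm_ge_zero[of \<alpha>] by linarith
  obtain \<psi> where \<psi>: "\<psi> holomorphic_on ball 0 1" "\<And>z. norm z < 1 \<Longrightarrow> \<phi> z = z * \<psi> z"
    "\<And>z. norm z < 1 \<Longrightarrow> norm (\<psi> z) \<le> 1"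
    using assms(7-9) by (rule Schwarz_quotient) blast
  define p where "p k n = (deriv ^^ n) (\<lambda>z. \<psi> z ^ k) 0 / fact n" for k n
  have \<psi>_pow: "(\<lambda>z. \<psi> z ^ k) holomorphic_on ball 0 1" for k
    by (intro holomorphic_intros \<psi>)
  have p_sums: "(\<lambda>n. p k n * z ^ n) sums (\<psi> z ^ k)" if "z \<in> ball 0 1" for k z
    unfolding p_def using holomorphic_power_series[OF \<psi>_pow that] by simp
  \<comment> \<open>Every power of \<open>\<psi>\<close> is again bounded by 1, so the bound is
    uniform in \<open>k\<close>.\<close>
  have p_le: "(\<Sum>n<N. norm (p k n) * r ^ n) \<le> 1" for k N
    unfolding p_def using \<psi>(3) assms(15) r
    by (intro scalar_bohr_inequality_partial_sum \<psi>_pow) (auto simp: norm_power power_le_one)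
  have H_le: "(\<Sum>n<N. norm (H n) * r ^ n) \<le> M" for N
    by (rule bohr_inequality_partial_sum[OF H assms(5) assms(12) assms(11) H0 assms(14-16)])
  \<comment> \<open>\<open>1/2\<close> serves as a point of convergence beyond
    \<open>r \<le> 1/3\<close>.\<close>
  have g_summable: "summable (\<lambda>n. norm (G n) * r ^ n)"
    using r assms(15) G[of "1/2"] by (intro power_series_norm_summable[of "1/2"]) (auto simp: sums_iff)
  have bound: "(\<Sum>n<N. norm (F n) * r ^ n) \<le> M * bohr_operator r g" for N
  proof -
    let ?T = "{..<N} \<times> {..<N} \<times> {..<N}"
    let ?d = "\<lambda>(i, k, j). i + (k + j) :: nat"
    let ?B = "\<lambda>(i, k, j). (norm (H i) * r ^ i) * ((norm (G k) * r ^ k) * (norm (p k j) * r ^ j))"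
    have F_le: "norm (F n) * r ^ n \<le> (\<Sum>t | t \<in> ?T \<and> ?d t = n. ?B t)" if "n < N" for n
    proof -
      have "F n = (\<Sum>(i, k, j) | (i, k, j) \<in> ?T \<and> i + (k + j) = n. p k j *\<^sub>C (H i o\<^sub>L G k))"
        using \<psi> by (intro composition_coeffs[OF F G H assms(5) p_sums _ _ assms(10) that]) auto
      then have "norm (F n) * r ^ n \<le> (\<Sum>t | t \<in> ?T \<and> ?d t = n. norm (case t of (i, k, j) \<Rightarrow> p k j *\<^sub>C (H i o\<^sub>L G k))) * r ^ n"
        using assms(15) by (simp add: case_prod_unfold mem_Times_iff mult_right_mono norm_sum)
      also have "\<dots> \<le> (\<Sum>t | t \<in> ?T \<and> ?d t = n. ?B t)"
        unfolding sum_distrib_right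
      proof (rule sum_mono, clarify)
        fix i k j
        have "norm (p k j *\<^sub>C (H i o\<^sub>L G k)) \<le> norm (p k j) * (norm (H i) * norm (G k))"
          unfolding norm_scaleC by (intro mult_left_mono norm_blinfun_compose) auto
        then have "norm (p k j *\<^sub>C (H i o\<^sub>L G k)) * r ^ (i + (k + j))
            \<le> norm (p k j) * (norm (H i) * norm (G k)) * r ^ (i + (k + j))"
          using assms(15) by (intro mult_right_mono) auto
        then show "norm (p k j *\<^sub>C (H i o\<^sub>L G k)) * r ^ (i + (k + j)) \<le>
            (norm (H i) * r ^ i) * ((norm (G k) * r ^ k) * (norm (p k j) * r ^ j))"
          by (simp add: power_add algebra_simps)
      qed
      finally show ?thesis .
    qed
    have "(\<Sum>n<N. norm (F n) * r ^ n) \<le> (\<Sum>n<N. \<Sum>t | t \<in> ?T \<and> ?d t = n. ?B t)"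
      by (intro sum_mono F_le) auto
    \<comment> \<open>The triples of total degree below \<open>N\<close> are partitioned by that
      degree, so the double sum collapses.\<close>
    also have "\<dots> = (\<Sum>n<N. \<Sum>t | t \<in> {t \<in> ?T. ?d t < N} \<and> ?d t = n. ?B t)"
      by (intro sum.cong refl) auto
    also have "\<dots> = (\<Sum>t | t \<in> ?T \<and> ?d t < N. ?B t)"
      by (rule sum.group) auto
    \<comment> \<open>The terms are nonnegative, so adding the triples of total degree at least
      \<open>N\<close> completes the cube, over which the sum over \<open>i\<close> splits
      off.\<close>
    also have "\<dots> \<le> (\<Sum>t\<in>?T. ?B t)"
      using assms(15) by (intro sum_mono2) auto
    \<comment> \<open>\<open>p k j\<close> depends on \<open>k\<close>, so the sum over
      \<open>j\<close> stays inside the sum over \<open>k\<close>.\<close>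
    also have "\<dots> = (\<Sum>i<N. norm (H i) * r ^ i) * (\<Sum>k<N. norm (G k) * r ^ k * (\<Sum>j<N. norm (p k j) * r ^ j))"
      unfolding sum_product
      by (simp add: sum_distrib_left sum.cartesian_product case_prod_unfold)
    also have "\<dots> \<le> M * (\<Sum>k<N. norm (G k) * r ^ k * 1)"
      using assms(15)
      by (intro mult_mono H_le sum_mono mult_left_mono p_le sum_nonneg M) (auto intro!: mult_nonneg_nonneg sum_nonneg)
    also have "\<dots> \<le> M * bohr_operator r g"
      unfolding bohr_operator_def F_G_H_def(2)[symmetric] mult_1_right
      using assms(15) by (intro mult_left_mono M sum_le_suminf g_summable) auto
    finally show ?thesis .
  qed
  have "summable (\<lambda>n. norm (F n) * r ^ n)"
    using r assms(15) F[of "1/2"] by (intro power_series_norm_summable[of "1/2"]) (auto simp: sums_iff)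
  then show ?thesis
    unfolding bohr_operator_def[of r f] F_G_H_def(1)[symmetric] using bound by (rule suminf_le_const)
qed

end
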